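(* Let $(M,g)$ be a smooth oriented Riemannian manifold with a symmetric affine connection $\nabla$ of components $\Gamma^i_{jk}$, with $g=(g_{ij})$ fixed and $\Gamma^i_{jk}$ regarded as the unknown. Consider the Lagrangian $$\mathcal{L}=\|\nabla\|^2\sqrt{\det(g_{ij})},\qquad \|\nabla\|^2= g_{ip}g^{jq}g^{kr}\Gamma^i_{jk}\Gamma^p_{qr},$$ of the functional $I(\nabla)=\int_M\|\nabla\|^2\,d\mu$. Then the only solutions of the Euler–Lagrange equations $\frac{\partial\mathcal{L}}{\partial\Gamma^s_{mn}}=0$ of $\mathcal{L}$ are the global minimum points $\Gamma^p_{qr}=0$.
   Context: Expressions are written in a local chart; summation over repeated indices is understood; $(g^{ij})$ is the inverse of $(g_{ij})$ and $d\mu=\sqrt{\det(g_{ij})}\,dx^1\wedge\cdots\wedge dx^n$. The Lagrangian is of order zero in $\Gamma^i_{jk}$, so the Euler–Lagrange equations are the algebraic equations $\partial\mathcal{L}/\partial\Gamma^s_{mn}=0$, where partial derivatives are formal: $\frac{\partial \Gamma^i_{jk}}{\partial \Gamma^s_{mn}}=\delta^i_s\delta^m_j\delta^n_k$. *)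

theory Defs
  imports "HOL-Analysis.Analysis"
begin

section \<open>Smooth maps on open sets\<close>

text \<open>Both notions below are only meaningful on open \<open>S\<close>, as the derivatives are taken in the full space.\<close>

fun Ck_on :: "nat \<Rightarrow> ('a::real_normed_vector \<Rightarrow> 'b::real_normed_vector) \<Rightarrow> 'a set \<Rightarrow> bool" where
  "Ck_on 0 f S \<longleftrightarrow> continuous_on S f"
| "Ck_on (Suc k) f S \<longleftrightarrow> (\<forall>x\<in>S. f differentiable (at x)) \<and>
     (\<forall>v. Ck_on k (\<lambda>x. frechet_derivative f (at x) v) S)"

definition smooth_on :: "('a::real_normed_vector \<Rightarrow> 'b::real_normed_vector) \<Rightarrow> 'a set \<Rightarrow> bool" where
  "smooth_on f S \<longleftrightarrow> (\<forall>k. Ck_on k f S)"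

definition pd :: "'n::finite \<Rightarrow> (real^'n \<Rightarrow> real^'m) \<Rightarrow> real^'n \<Rightarrow> real^'m" where
  "pd i f x = frechet_derivative f (at x) (axis i 1)"

section \<open>Oriented Riemannian manifolds\<close>

text \<open>A chart is a coordinate neighbourhood together with its coordinate map; values of the map
  outside the neighbourhood are irrelevant. Manifolds are of dimension \<open>CARD('n)\<close>.\<close>

type_synonym ('a, 'n) chart = "'a set \<times> ('a \<Rightarrow> real^'n)"

definition chart_image :: "('a, 'n::finite) chart \<Rightarrow> (real^'n) set" where
  "chart_image c = snd c ` fst c"

definition transition :: "('a, 'n::finite) chart \<Rightarrow> ('a, 'n) chart \<Rightarrow> real^'n \<Rightarrow> real^'n" where
  "transition c d x = snd d (inv_into (fst c) (snd c) x)"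

definition overlap :: "('a, 'n::finite) chart \<Rightarrow> ('a, 'n) chart \<Rightarrow> (real^'n) set" where
  "overlap c d = snd c ` (fst c \<inter> fst d)"

text \<open>\<open>jacobian c d x $ a $ i\<close> is the partial derivative of the \<open>a\<close>-th coordinate of \<open>d\<close>
  with respect to the \<open>i\<close>-th coordinate of \<open>c\<close>.\<close>

definition jacobian :: "('a, 'n::finite) chart \<Rightarrow> ('a, 'n) chart \<Rightarrow> real^'n \<Rightarrow> real^'n^'n" where
  "jacobian c d x = (\<chi> a i. pd i (transition c d) x $ a)"

definition oriented_smooth_manifold :: "'a topology \<Rightarrow> ('a, 'n::finite) chart set \<Rightarrow> bool" where
  "oriented_smooth_manifold X A \<longleftrightarrow>
     Hausdorff_space X \<and> second_countable X \<and>
     (\<Union>c\<in>A. fst c) = topspace X \<and>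
     (\<forall>c\<in>A. openin X (fst c) \<and> open (chart_image c) \<and>
        homeomorphic_map (subtopology X (fst c)) (top_of_set (chart_image c)) (snd c)) \<and>
     (\<forall>c\<in>A. \<forall>d\<in>A. smooth_on (transition c d) (overlap c d) \<and>
        (\<forall>x\<in>overlap c d. det (jacobian c d x) > 0))"

text \<open>Tensors and connections are given by their components in every chart of the atlas:
  \<open>g c x $ i $ j\<close> is the value of \<open>g\<^sub>i\<^sub>j\<close>, in the coordinates of \<open>c\<close>, at the point with coordinates \<open>x\<close>.\<close>

definition riemannian_metric ::
  "('a, 'n::finite) chart set \<Rightarrow> (('a, 'n) chart \<Rightarrow> real^'n \<Rightarrow> real^'n^'n) \<Rightarrow> bool" where
  "riemannian_metric A g \<longleftrightarrow>
     (\<forall>c\<in>A. smooth_on (g c) (chart_image c) \<and>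
        (\<forall>x\<in>chart_image c. transpose (g c x) = g c x \<and>
           (\<forall>v. v \<noteq> 0 \<longrightarrow> v \<bullet> (g c x *v v) > 0))) \<and>
     (\<forall>c\<in>A. \<forall>d\<in>A. \<forall>x\<in>overlap c d. \<forall>i j.
        g c x $ i $ j = (\<Sum>a\<in>UNIV. \<Sum>b\<in>UNIV.
          g d (transition c d x) $ a $ b * jacobian c d x $ a $ i * jacobian c d x $ b $ j))"

definition oriented_riemannian_manifold ::
  "'a topology \<Rightarrow> ('a, 'n::finite) chart set \<Rightarrow> (('a, 'n) chart \<Rightarrow> real^'n \<Rightarrow> real^'n^'n) \<Rightarrow> bool" where
  "oriented_riemannian_manifold X A g \<longleftrightarrow> oriented_smooth_manifold X A \<and> riemannian_metric A g"

section \<open>Symmetric affine connections\<close>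

text \<open>\<open>G $ i $ j $ k\<close> stands for the component with upper index \<open>i\<close> and lower indices \<open>j, k\<close>.\<close>

type_synonym 'n components = "real^'n^'n^'n"

definition symmetric_components_on :: "(real^'n) set \<Rightarrow> (real^'n \<Rightarrow> ('n::finite) components) \<Rightarrow> bool" where
  "symmetric_components_on U G \<longleftrightarrow>
     smooth_on G U \<and> (\<forall>x\<in>U. \<forall>i j k. G x $ i $ j $ k = G x $ i $ k $ j)"

text \<open>The last clause is the transformation law of Christoffel symbols: both sides are the
  component along the \<open>a\<close>-th coordinate field of \<open>d\<close> of the derivative of the \<open>k\<close>-th coordinate
  field of \<open>c\<close> along the \<open>j\<close>-th one.\<close>

definition symmetric_affine_connection ::
  "('a, 'n::finite) chart set \<Rightarrow> (('a, 'n) chart \<Rightarrow> real^'n \<Rightarrow> 'n components) \<Rightarrow> bool" where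
  "symmetric_affine_connection A \<Gamma> \<longleftrightarrow>
     (\<forall>c\<in>A. symmetric_components_on (chart_image c) (\<Gamma> c)) \<and>
     (\<forall>c\<in>A. \<forall>d\<in>A. \<forall>x\<in>overlap c d. \<forall>a j k.
        (\<Sum>i\<in>UNIV. jacobian c d x $ a $ i * \<Gamma> c x $ i $ j $ k) =
        pd j (pd k (transition c d)) x $ a +
        (\<Sum>b\<in>UNIV. \<Sum>e\<in>UNIV. \<Gamma> d (transition c d x) $ a $ b $ e *
           jacobian c d x $ b $ j * jacobian c d x $ e $ k))"

section \<open>The Lagrangian\<close>

definition norm_sq :: "real^'n^'n \<Rightarrow> ('n::finite) components \<Rightarrow> real" where
  "norm_sq h G = (\<Sum>i\<in>UNIV. \<Sum>p\<in>UNIV. \<Sum>j\<in>UNIV. \<Sum>q\<in>UNIV. \<Sum>k\<in>UNIV. \<Sum>r\<in>UNIV.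
     h $ i $ p * matrix_inv h $ j $ q * matrix_inv h $ k $ r * G $ i $ j $ k * G $ p $ q $ r)"

definition lagrangian :: "real^'n^'n \<Rightarrow> ('n::finite) components \<Rightarrow> real" where
  "lagrangian h G = norm_sq h G * sqrt (det h)"

text \<open>The partial derivative with respect to the component \<open>(s, m, n)\<close>, with all \<open>CARD('n)^3\<close>
  components treated as independent variables: symmetry in the lower indices is not imposed on
  the variations.\<close>

definition partial_deriv :: "('n::finite components \<Rightarrow> real) \<Rightarrow> 'n \<Rightarrow> 'n \<Rightarrow> 'n \<Rightarrow> 'n components \<Rightarrow> real" where
  "partial_deriv F s m n G = deriv (\<lambda>t. F (G + t *\<^sub>R axis s (axis m (axis n 1)))) 0"

definition euler_lagrange ::
  "(real^'n \<Rightarrow> real^'n^'n) \<Rightarrow> (real^'n) set \<Rightarrow> (real^'n \<Rightarrow> ('n::finite) components) \<Rightarrow> bool" where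
  "euler_lagrange h U G \<longleftrightarrow> (\<forall>x\<in>U. \<forall>s m n. partial_deriv (lagrangian (h x)) s m n (G x) = 0)"

text \<open>The functional \<open>I\<close> over a coordinate domain. For positive definite \<open>h\<close> the integrand is nonnegative;
  the integral is extended-real-valued since it may diverge.\<close>

definition energy ::
  "(real^'n \<Rightarrow> real^'n^'n) \<Rightarrow> (real^'n) set \<Rightarrow> (real^'n \<Rightarrow> ('n::finite) components) \<Rightarrow> ennreal" where
  "energy h U G = (\<integral>\<^sup>+x\<in>U. ennreal (lagrangian (h x) (G x)) \<partial>lborel)"

definition global_minimum ::
  "(real^'n \<Rightarrow> real^'n^'n) \<Rightarrow> (real^'n) set \<Rightarrow> (real^'n \<Rightarrow> ('n::finite) components) \<Rightarrow> bool" where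
  "global_minimum h U G \<longleftrightarrow> symmetric_components_on U G \<and>
     (\<forall>G'. symmetric_components_on U G' \<longrightarrow> energy h U G \<le> energy h U G')"

end

theory Submission imports Defs
begin

text \<open>The squared norm of the components is the quadratic form of the bilinear form
  \<open>g \<otimes> g\<inverse> \<otimes> g\<inverse>\<close>, which is positive definite because tensoring an inner product with a
  positive definite matrix again gives an inner product (complete one square per index).
  The partial derivatives of the Lagrangian at \<open>G\<close> are, up to the factor \<open>2 * sqrt (det g) > 0\<close>, the
  pairings of \<open>G\<close> with the basis vectors, so they all vanish only at \<open>G = 0\<close>. The energy of the
  zero field is \<open>0\<close>, hence a minimiser has vanishing energy, and a continuous nonnegative
  integrand with vanishing integral over an open set is zero.\<close>

section \<open>Inner products on real vector spaces and their tensoring with positive definite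
  matrices\<close>

definition inner_form :: "('w::real_vector \<Rightarrow> 'w \<Rightarrow> real) \<Rightarrow> bool" where
  "inner_form M \<longleftrightarrow> bilinear M \<and> (\<forall>x y. M x y = M y x) \<and> (\<forall>x. x \<noteq> 0 \<longrightarrow> M x x > 0)"

definition pos_def :: "real^'n^'n \<Rightarrow> bool" where
  "pos_def h \<longleftrightarrow> transpose h = h \<and> (\<forall>v. v \<noteq> 0 \<longrightarrow> v \<bullet> (h *v v) > 0)"

lemma inner_form_times: "inner_form ((*) :: real \<Rightarrow> real \<Rightarrow> real)"
  by (auto simp: inner_form_def bilinear_def linear_iff algebra_simps zero_less_mult_iff)

text \<open>One step of Lagrange's reduction, with vectors \<open>w i\<close> in place of real
  unknowns: the remaining coefficients form the Schur complement of \<open>h a a\<close>. No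
  positivity of \<open>M\<close> enters, only symmetry and bilinearity.\<close>

lemma complete_square:
  fixes M :: "'w::real_vector \<Rightarrow> 'w \<Rightarrow> real" and w :: "'i \<Rightarrow> 'w"
  assumes M: "bilinear M" "\<And>x y. M x y = M y x"
    and S: "finite S" "a \<notin> S" and sym: "\<And>i. i \<in> S \<Longrightarrow> h i a = h a i" and "h a a \<noteq> 0"
  defines "z \<equiv> w a + (1 / h a a) *\<^sub>R (\<Sum>i\<in>S. h a i *\<^sub>R w i)"
  shows "(\<Sum>i\<in>insert a S. \<Sum>j\<in>insert a S. h i j * M (w i) (w j)) =
    h a a * M z z + (\<Sum>i\<in>S. \<Sum>j\<in>S. (h i j - h a i * h a j / h a a) * M (w i) (w j))"
proof -
  define P where "P = (\<Sum>i\<in>S. h a i *\<^sub>R w i)"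
  have lin: "linear (M x)" for x using M(1) by (simp add: bilinear_def)
  have 1: "M x P = (\<Sum>i\<in>S. h a i * M x (w i))" for x
    unfolding P_def by (simp add: linear_sum[OF lin] linear_cmul[OF lin])
  have 2: "M P P = (\<Sum>i\<in>S. \<Sum>j\<in>S. h a i * h a j * M (w i) (w j))"
    unfolding 1 M(2)[of P] by (simp add: 1 sum_distrib_left mult.assoc)
  have 3: "M z z = M (w a) (w a) + 2 / h a a * M (w a) P + 1 / (h a a * h a a) * M P P"
    unfolding z_def P_def[symmetric]
    using M(2)[of P "w a"] by (simp add: bilinear_ladd[OF M(1)] bilinear_radd[OF M(1)] bilinear_lmul[OF M(1)]
        bilinear_rmul[OF M(1)] add_divide_distrib algebra_simps)
  have 4: "(\<Sum>i\<in>S. h i a * M (w i) (w a)) = M (w a) P"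
    unfolding 1 by (rule sum.cong) (auto simp: sym M(2)[of _ "w a"])
  have "(\<Sum>i\<in>insert a S. \<Sum>j\<in>insert a S. h i j * M (w i) (w j)) =
     h a a * M (w a) (w a) + 2 * M (w a) P + (\<Sum>i\<in>S. \<Sum>j\<in>S. h i j * M (w i) (w j))"
    using S by (simp add: sum.distrib 4 1[of "w a", symmetric])
  moreover have "(\<Sum>i\<in>S. \<Sum>j\<in>S. (h i j - h a i * h a j / h a a) * M (w i) (w j)) =
     (\<Sum>i\<in>S. \<Sum>j\<in>S. h i j * M (w i) (w j)) - M P P / h a a"
    unfolding 2 by (simp add: left_diff_distrib sum_subtractf sum_divide_distrib)
  ultimately show ?thesis
    unfolding 3 using \<open>h a a \<noteq> 0\<close> by (simp add: distrib_left)
qed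

text \<open>Positivity of \<open>h\<close> on real unknowns passes to vector unknowns. By induction
  on \<open>S\<close>: completing the square at \<open>a\<close> leaves the Schur complement
  \<open>k\<close>, which is again positive definite on \<open>S\<close>.\<close>

lemma inner_form_quadratic_pos:
  fixes M :: "'w::real_vector \<Rightarrow> 'w \<Rightarrow> real" and w :: "'i \<Rightarrow> 'w"
  assumes "finite S" and M: "inner_form M"
    and "\<And>i j. i \<in> S \<Longrightarrow> j \<in> S \<Longrightarrow> h i j = h j i"
    and "\<And>v. (\<exists>i\<in>S. v i \<noteq> 0) \<Longrightarrow> (\<Sum>i\<in>S. \<Sum>j\<in>S. h i j * (v i * v j)) > (0::real)"
    and "\<exists>i\<in>S. w i \<noteq> 0"
  shows "(\<Sum>i\<in>S. \<Sum>j\<in>S. h i j * M (w i) (w j)) > 0"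
  using assms(1,3-)
proof (induction S arbitrary: h rule: finite_induct)
  case empty
  then show ?case by simp
next
  case (insert a S)
  note sym = insert.prems(1) and pos = insert.prems(2)
  have Mb: "bilinear M" "\<And>x y. M x y = M y x" and Mp: "\<And>x. x \<noteq> 0 \<Longrightarrow> M x x > 0"
    using M by (auto simp: inner_form_def)
  \<comment> \<open>The square is completed twice: with \<open>M\<close> for the goal, and with real
    multiplication to carry the positivity of \<open>h\<close> over to \<open>k\<close>.\<close>
  have Rb: "bilinear ((*) :: real \<Rightarrow> real \<Rightarrow> real)" "\<And>x y. x * y = y * (x::real)"
    using inner_form_times by (auto simp: inner_form_def)
  have haa: "h a a > 0"
    using pos[of "\<lambda>i. if i = a then 1 else 0"] insert.hyps
    by (simp add: if_distrib[of "(*) _"] if_distrib[of "\<lambda>x. x * _"] sum.neutral cong: if_cong)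
  define k where "k i j = h i j - h a i * h a j / h a a" for i j
  define z where "z = w a + (1 / h a a) *\<^sub>R (\<Sum>i\<in>S. h a i *\<^sub>R w i)"
  have eq: "(\<Sum>i\<in>insert a S. \<Sum>j\<in>insert a S. h i j * M (w i) (w j)) =
      h a a * M z z + (\<Sum>i\<in>S. \<Sum>j\<in>S. k i j * M (w i) (w j))"
    unfolding z_def k_def using complete_square[OF Mb insert.hyps, of h w] sym haa by simp
  have k_pos: "(\<Sum>i\<in>S. \<Sum>j\<in>S. k i j * (v i * v j)) > 0" if v: "\<exists>i\<in>S. v i \<noteq> 0" for v
  proof -
    \<comment> \<open>the value at \<open>a\<close> is chosen to make the completed square vanish\<close>
    define v' where "v' = v(a := - (1 / h a a) * (\<Sum>i\<in>S. h a i * v i))"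
    have v'S: "v' i = v i" if "i \<in> S" for i using that insert.hyps by (auto simp: v'_def)
    have "(\<Sum>i\<in>insert a S. \<Sum>j\<in>insert a S. h i j * (v' i * v' j)) > 0"
      using v v'S by (intro pos) force
    also have "(\<Sum>i\<in>insert a S. \<Sum>j\<in>insert a S. h i j * (v' i * v' j)) =
        (\<Sum>i\<in>S. \<Sum>j\<in>S. k i j * (v' i * v' j))"
      using complete_square[OF Rb insert.hyps, of h v'] sym haa v'S
      by (simp add: k_def v'_def cong: sum.cong)
    finally show ?thesis using v'S by (simp cong: sum.cong)
  qed
  have k_sym: "k i j = k j i" if "i \<in> S" "j \<in> S" for i j
    using sym[of i j] that by (simp add: k_def)
  show ?case
  \<comment> \<open>Either the Schur complement part is already positive, or it vanishes and
    \<open>z = w a\<close> makes the square positive.\<close>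
  proof (cases "\<exists>i\<in>S. w i \<noteq> 0")
    case True
    have "h a a * M z z \<ge> 0"
      using Mp[of z] bilinear_lzero[OF Mb(1), of z] haa by (cases "z = 0") (auto simp: less_imp_le)
    with insert.IH[OF k_sym k_pos True] show ?thesis unfolding eq by linarith
  next
    case False
    then have "z = w a" "w a \<noteq> 0" "\<And>i. i \<in> S \<Longrightarrow> w i = 0" using insert.prems(3) by (auto simp: z_def)
    then show ?thesis unfolding eq using Mp[of z] haa by (simp add: bilinear_lzero[OF Mb(1)])
  qed
qed

text \<open>The tensor product of the forms \<open>h\<close> and \<open>M\<close>, with
  \<open>'w^'n\<close> playing the role of the tensor product space. Leaving \<open>'w\<close>
  arbitrary allows nesting, one index at a time.\<close>

definition matrix_form :: "real^'n^'n \<Rightarrow> ('w \<Rightarrow> 'w \<Rightarrow> real) \<Rightarrow> 'w^'n \<Rightarrow> 'w^('n::finite) \<Rightarrow> real" where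
  "matrix_form h M v w = (\<Sum>i\<in>UNIV. \<Sum>j\<in>UNIV. h $ i $ j * M (v $ i) (w $ j))"

lemma inner_form_matrix_form:
  fixes h :: "real^'n^'n::finite"
  assumes h: "pos_def h" and M: "inner_form M"
  shows "inner_form (matrix_form h M)"
proof -
  have Mb: "bilinear M" "\<And>x y. M x y = M y x"
    using M by (auto simp: inner_form_def)
  have sym: "h $ i $ j = h $ j $ i" for i j
    using h unfolding pos_def_def by (metis transpose_def vec_lambda_beta)
  have "bilinear (matrix_form h M)"
    unfolding bilinear_def linear_iff matrix_form_def
    by (simp add: bilinear_ladd[OF Mb(1)] bilinear_radd[OF Mb(1)] bilinear_lmul[OF Mb(1)]
        bilinear_rmul[OF Mb(1)] distrib_left sum.distrib sum_distrib_left mult.left_commute)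
  moreover have "matrix_form h M v w = matrix_form h M w v" for v w
    unfolding matrix_form_def by (subst sum.swap) (simp add: sym Mb(2)[of "v $ _"])
  moreover have "matrix_form h M w w > 0" if "w \<noteq> 0" for w
    unfolding matrix_form_def
  proof (rule inner_form_quadratic_pos[OF finite M sym])
    fix v :: "'n \<Rightarrow> real" assume "\<exists>i\<in>UNIV. v i \<noteq> 0"
    then have "vec_lambda v \<noteq> 0" by (simp add: vec_eq_iff)
    with h have "vec_lambda v \<bullet> (h *v vec_lambda v) > 0" by (simp add: pos_def_def)
    then show "(\<Sum>i\<in>UNIV. \<Sum>j\<in>UNIV. h $ i $ j * (v i * v j)) > 0"
      by (simp add: inner_vec_def matrix_vector_mult_def sum_distrib_left mult_ac)
  qed (use that in \<open>simp add: vec_eq_iff\<close>)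
  ultimately show ?thesis by (simp add: inner_form_def)
qed

section \<open>Positive definite matrices: inverse and determinant\<close>

lemma pos_def_invertible:
  assumes "pos_def h" shows "invertible h"
proof -
  have "v = 0" if "h *v v = 0" for v
    using assms that by (force simp: pos_def_def)
  then show ?thesis by (simp add: invertible_left_inverse matrix_left_invertible_ker)
qed

lemma matrix_inv_cancel:
  assumes "invertible h"
  shows "h ** matrix_inv h = mat 1" "matrix_inv h ** h = mat 1"
  using someI_ex[OF assms[unfolded invertible_def]] by (simp_all add: matrix_inv_def)

text \<open>Substituting \<open>v = h *v u\<close> turns the quadratic form of the inverse at
  \<open>v\<close> into that of \<open>h\<close> at \<open>u\<close>.\<close>

lemma pos_def_matrix_inv:
  fixes h :: "real^'n^'n::finite"
  assumes "pos_def h" shows "pos_def (matrix_inv h)"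
proof -
  have inv: "h ** matrix_inv h = mat 1" "matrix_inv h ** h = mat 1"
    using matrix_inv_cancel[OF pos_def_invertible[OF assms]] .
  \<comment> \<open>The transposed inverse is a left inverse of \<open>h\<close>, hence equal to the
    right inverse.\<close>
  have "transpose (matrix_inv h) ** h = mat 1"
    using arg_cong[OF inv(1), of transpose] assms by (simp add: matrix_transpose_mul pos_def_def)
  then have "transpose (matrix_inv h) = matrix_inv h"
    by (metis inv(1) matrix_mul_assoc matrix_mul_lid matrix_mul_rid)
  moreover have "v \<bullet> (matrix_inv h *v v) > 0" if "v \<noteq> 0" for v
  proof -
    define u where "u = matrix_inv h *v v"
    have v: "v = h *v u" by (simp add: u_def matrix_vector_mul_assoc inv)
    with that have "u \<noteq> 0" by auto
    then have "u \<bullet> (h *v u) > 0" using that assms by (auto simp: pos_def_def)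
    then show ?thesis by (metis v u_def inner_commute)
  qed
  ultimately show ?thesis by (simp add: pos_def_def)
qed

lemma continuous_on_det:
  fixes B :: "'x::topological_space \<Rightarrow> real^'n^'n"
  assumes "\<And>i j. continuous_on S (\<lambda>x. B x $ i $ j)"
  shows "continuous_on S (\<lambda>x. det (B x))"
  unfolding det_def by (intro continuous_intros assms)

text \<open>The segment from the identity to \<open>h\<close> consists of positive definite, hence
  invertible, matrices. The determinant is 1 at its start and never vanishes, so it cannot change
  sign.\<close>

lemma pos_def_det_pos:
  fixes h :: "real^'n^'n::finite"
  assumes "pos_def h" shows "det h > 0"
proof (rule ccontr)
  define B where "B t = (1 - t) *\<^sub>R mat 1 + t *\<^sub>R h" for t
  have "pos_def (B t)" if "0 \<le> t" "t \<le> 1" for t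
  proof -
    have "v \<bullet> (B t *v v) > 0" if "v \<noteq> 0" for v
    proof -
      have "v \<bullet> (B t *v v) = (1 - t) * (v \<bullet> v) + t * (v \<bullet> (h *v v))"
        by (simp add: B_def matrix_vector_mult_add_rdistrib inner_add_right scaleR_matrix_vector_assoc[symmetric])
      moreover have "v \<bullet> v > 0" "v \<bullet> (h *v v) > 0" using that assms by (auto simp: pos_def_def)
      \<comment> \<open>For \<open>t > 0\<close> the second summand is positive, for
        \<open>t = 0\<close> the first.\<close>
      ultimately show ?thesis using \<open>0 \<le> t\<close> \<open>t \<le> 1\<close>
        by (cases "t = 0") (auto intro: add_nonneg_pos)
    qed
    moreover have "transpose (B t) = B t"
      using assms by (auto simp: pos_def_def B_def transpose_def vec_eq_iff mat_def)
    ultimately show ?thesis by (simp add: pos_def_def)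
  qed
  then have nz: "det (B t) \<noteq> 0" if "0 \<le> t" "t \<le> 1" for t
    using that pos_def_invertible invertible_det_nz by blast
  assume "\<not> det h > 0"
  moreover have "continuous_on {0..1} (\<lambda>t. det (B t))"
    unfolding B_def by (intro continuous_on_det) (auto intro!: continuous_intros)
  moreover have "det (B 0) = 1" "det (B 1) = det h" by (auto simp: B_def)
  ultimately obtain t where "0 \<le> t" "t \<le> 1" "det (B t) = 0"
    using IVT2'[of "\<lambda>t. det (B t)" 1 0 0] by auto
  with nz show False by blast
qed

section \<open>The Lagrangian as a quadratic form and its critical points\<close>

definition component_form :: "real^'n^'n \<Rightarrow> 'n components \<Rightarrow> ('n::finite) components \<Rightarrow> real" where
  "component_form h = matrix_form h (matrix_form (matrix_inv h) (matrix_form (matrix_inv h) (*)))"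

text \<open>The sums in \<open>norm_sq\<close> are ordered like the nested forms, so distributivity
  suffices.\<close>

lemma norm_sq_component_form: "norm_sq h G = component_form h G G"
  unfolding norm_sq_def component_form_def matrix_form_def
  by (simp add: sum_distrib_left mult.assoc)

lemma inner_form_component_form: "pos_def h \<Longrightarrow> inner_form (component_form h)"
  unfolding component_form_def
  by (intro inner_form_matrix_form pos_def_matrix_inv inner_form_times)

lemma lagrangian_zero [simp]: "lagrangian h 0 = 0"
  by (simp add: lagrangian_def norm_sq_def)

lemma lagrangian_pos:
  assumes "pos_def h" "G \<noteq> 0" shows "lagrangian h G > 0"
  using inner_form_component_form[OF assms(1)] pos_def_det_pos[OF assms(1)] assms(2)
  by (simp add: lagrangian_def norm_sq_component_form inner_form_def)

lemma lagrangian_nonneg: "pos_def h \<Longrightarrow> lagrangian h G \<ge> 0"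
  using lagrangian_pos[of h G] by (cases "G = 0") auto

text \<open>Along a line in direction \<open>E\<close> the Lagrangian is a quadratic polynomial in
  \<open>t\<close>; symmetry of the form merges the two mixed terms into the factor 2.\<close>

lemma partial_deriv_lagrangian:
  assumes "pos_def h"
  shows "partial_deriv (lagrangian h) s m n G =
    2 * component_form h G (axis s (axis m (axis n 1))) * sqrt (det h)"
proof -
  define E :: "'a components" where "E = axis s (axis m (axis n 1))"
  have b: "bilinear (component_form h)" "component_form h E G = component_form h G E"
    using inner_form_component_form[OF assms] by (auto simp: inner_form_def)
  have "(\<lambda>t. lagrangian h (G + t *\<^sub>R E)) = (\<lambda>t. (component_form h G G + 2 * t * component_form h G E
      + t^2 * component_form h E E) * sqrt (det h))"
    by (auto simp: lagrangian_def norm_sq_component_form bilinear_ladd[OF b(1)] bilinear_radd[OF b(1)]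
        bilinear_lmul[OF b(1)] bilinear_rmul[OF b(1)] b(2) power2_eq_square algebra_simps)
  moreover have "((\<lambda>t. (component_form h G G + 2 * t * component_form h G E
      + t^2 * component_form h E E) * sqrt (det h)) has_field_derivative
      2 * component_form h G E * sqrt (det h)) (at 0)"
    by (auto intro!: derivative_eq_intros)
  ultimately show ?thesis
    unfolding partial_deriv_def E_def[symmetric] by (simp add: DERIV_imp_deriv)
qed

lemma critical_lagrangian_iff:
  assumes "pos_def h"
  shows "(\<forall>s m n. partial_deriv (lagrangian h) s m n G = 0) \<longleftrightarrow> G = 0"
proof
  have b: "bilinear (component_form h)" and p: "G \<noteq> 0 \<Longrightarrow> component_form h G G > 0"
    using inner_form_component_form[OF assms] by (auto simp: inner_form_def)
  then have lin: "linear (component_form h G)" by (simp add: bilinear_def)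
  assume "\<forall>s m n. partial_deriv (lagrangian h) s m n G = 0"
  then have "component_form h G (axis s (axis m (axis n 1))) = 0" for s m n
    using pos_def_det_pos[OF assms] by (simp add: partial_deriv_lagrangian[OF assms])
  \<comment> \<open>The iterated \<open>axis\<close> vectors are exactly the standard basis of the
    space of components.\<close>
  then have "component_form h G E = 0" if "E \<in> Basis" for E
    using that by (auto simp: Basis_vec_def)
  then have "component_form h G = (\<lambda>_. 0)"
    by (intro linear_eq_stdbasis[OF lin linear_zero])
  \<comment> \<open>The functional vanishes in particular at \<open>G\<close> itself, against
    definiteness unless \<open>G = 0\<close>.\<close>
  then show "G = 0" using p by force
next
  have b: "bilinear (component_form h)"
    using inner_form_component_form[OF assms] by (auto simp: inner_form_def)
  assume "G = 0"
  then show "\<forall>s m n. partial_deriv (lagrangian h) s m n G = 0"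
    by (simp add: partial_deriv_lagrangian[OF assms] bilinear_lzero[OF b])
qed

section \<open>Continuity of the Lagrangian density\<close>

text \<open>Cramer's rule for column \<open>q\<close> of the inverse. It reduces continuity of the
  inverse to that of determinants.\<close>

lemma matrix_inv_component:
  fixes h :: "real^'n^'n::finite"
  assumes "det h \<noteq> 0"
  shows "matrix_inv h $ j $ q = det (\<chi> i l. if l = j then (if i = q then 1 else 0) else h $ i $ l) / det h"
proof -
  have "h *v (matrix_inv h *v axis q 1) = axis q 1"
    using assms by (simp add: matrix_vector_mul_assoc matrix_inv_cancel invertible_det_nz)
  then have "matrix_inv h *v axis q 1 =
      (\<chi> k. det (\<chi> i l. if l = k then axis q 1 $ i else h $ i $ l) / det h)"
    using cramer[OF assms] by blast
  then have "(matrix_inv h *v axis q 1) $ j = det (\<chi> i l. if l = j then axis q 1 $ i else h $ i $ l) / det h"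
    by simp
  moreover have "(matrix_inv h *v axis q 1) $ j = matrix_inv h $ j $ q"
    by (simp add: matrix_vector_mult_basis column_def)
  moreover have "axis q (1::real) $ i = (if i = q then 1 else 0)" for i
    by (simp add: axis_def)
  ultimately show ?thesis by (simp cong: if_cong)
qed

lemma continuous_on_lagrangian:
  fixes h :: "'x::topological_space \<Rightarrow> real^'n^'n::finite"
  assumes h: "continuous_on U h" and G: "continuous_on U G" and nz: "\<And>x. x \<in> U \<Longrightarrow> det (h x) \<noteq> 0"
  shows "continuous_on U (\<lambda>x. lagrangian (h x) (G x))"
proof -
  have hc: "continuous_on U (\<lambda>x. h x $ i $ j)" for i j by (intro continuous_intros h)
  have Gc: "continuous_on U (\<lambda>x. G x $ i $ j $ k)" for i j k by (intro continuous_intros G)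
  have d: "continuous_on U (\<lambda>x. det (h x))" by (rule continuous_on_det) (rule hc)
  have "continuous_on U (\<lambda>x. matrix_inv (h x) $ j $ q)" for j q
  proof (subst continuous_on_cong[OF refl matrix_inv_component])
    have "continuous_on U (\<lambda>x. (\<chi> i l. if l = j then (if i = q then 1 else 0) else h x $ i $ l) $ a $ b)" for a b
      \<comment> \<open>Column \<open>j\<close> is constant in \<open>x\<close>; the other columns
        are those of \<open>h x\<close>.\<close>
      by (cases "b = j") (simp_all add: hc)
    then show "continuous_on U (\<lambda>x. det (\<chi> i l. if l = j then (if i = q then 1 else 0) else h x $ i $ l) / det (h x))"
      by (intro continuous_on_divide d continuous_on_det ballI nz)
  qed (use nz in auto)
  then show ?thesis
    unfolding lagrangian_def norm_sq_def by (intro continuous_on_mult continuous_on_sum continuous_on_real_sqrt d hc Gc)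
qed

section \<open>Vanishing energy and minimisers\<close>

text \<open>If \<open>f x > 0\<close>, then \<open>f\<close> exceeds \<open>f x / 2\<close> on a
  ball inside \<open>U\<close>, and the integral is at least this bound times the positive volume of
  the ball.\<close>

lemma nn_integral_continuous_eq_0D:
  fixes f :: "'a::euclidean_space \<Rightarrow> real"
  assumes "open U" "continuous_on U f" "\<And>x. x \<in> U \<Longrightarrow> f x \<ge> 0"
    and int: "(\<integral>\<^sup>+x\<in>U. ennreal (f x) \<partial>lborel) = 0" and "x \<in> U"
  shows "f x = 0"
proof (rule ccontr)
  assume "f x \<noteq> 0"
  then have "f x / 2 > 0" "f x / 2 < f x" using assms(3)[OF \<open>x \<in> U\<close>] by auto
  moreover have "open {y \<in> U. f y > f x / 2}"
    using continuous_open_preimage[OF assms(2,1), of "{f x / 2<..}"] by (simp add: vimage_def Int_def)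
  ultimately obtain e where e: "e > 0" "ball x e \<subseteq> {y \<in> U. f y > f x / 2}"
    using \<open>x \<in> U\<close> by (metis (mono_tags, lifting) mem_Collect_eq openE)
  have "ennreal (f x / 2) * emeasure lborel (ball x e) =
      (\<integral>\<^sup>+y. ennreal (f x / 2) * indicator (ball x e) y \<partial>lborel)"
    by (simp add: nn_integral_cmult_indicator)
  also have "\<dots> \<le> (\<integral>\<^sup>+x\<in>U. ennreal (f x) \<partial>lborel)"
    using e(2) by (intro nn_integral_mono) (auto simp: indicator_def intro!: ennreal_leI)
  finally have "emeasure lborel (ball x e) = 0"
    using \<open>f x / 2 > 0\<close> int by (auto simp: ennreal_eq_0_iff)
  moreover have "emeasure lborel (ball x e) > 0"
    using e(1) by (simp add: emeasure_ball unit_ball_vol_pos)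
  ultimately show False by simp
qed

lemma smooth_on_imp_continuous_on: "smooth_on f U \<Longrightarrow> continuous_on U f"
  by (metis Ck_on.simps(1) smooth_on_def)

lemma smooth_on_zero: "smooth_on (\<lambda>_. 0) U"
proof -
  have "frechet_derivative (\<lambda>_::'a. 0::'b) (at x) = (\<lambda>_. 0)" for x
    by (metis frechet_derivative_at has_derivative_const)
  then have "Ck_on k (\<lambda>_::'a. 0::'b) U" for k
    by (induction k) auto
  then show ?thesis by (simp add: smooth_on_def)
qed

text \<open>Makes the zero field an admissible competitor in \<open>global_minimum\<close>.\<close>

lemma symmetric_components_on_zero: "symmetric_components_on U (\<lambda>_. 0)"
  by (simp add: symmetric_components_on_def smooth_on_zero)

lemma energy_eq_0_iff:
  assumes "open U" "continuous_on U h" "continuous_on U G" "\<And>x. x \<in> U \<Longrightarrow> pos_def (h x)"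
  shows "energy h U G = 0 \<longleftrightarrow> (\<forall>x\<in>U. G x = 0)"
proof
  assume *: "energy h U G = 0"
  have "continuous_on U (\<lambda>x. lagrangian (h x) (G x))"
    using assms pos_def_det_pos by (intro continuous_on_lagrangian) force+
  then have "lagrangian (h x) (G x) = 0" if "x \<in> U" for x
    using * assms that unfolding energy_def
    by (intro nn_integral_continuous_eq_0D[of U "\<lambda>x. lagrangian (h x) (G x)" x] lagrangian_nonneg) auto
  then show "\<forall>x\<in>U. G x = 0"
    using lagrangian_pos assms(4) by (metis less_irrefl)
next
  assume "\<forall>x\<in>U. G x = 0"
  then have "(\<lambda>x. ennreal (lagrangian (h x) (G x)) * indicator U x) = (\<lambda>_. 0)"
    by (auto simp: fun_eq_iff split: split_indicator)
  then show "energy h U G = 0" by (simp add: energy_def)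
qed

text \<open>The zero field has energy 0, the least extended nonnegative real, so the minimisers are
  exactly the admissible fields of zero energy.\<close>

lemma global_minimum_iff:
  assumes "open U" "continuous_on U h" "symmetric_components_on U G" "\<And>x. x \<in> U \<Longrightarrow> pos_def (h x)"
  shows "global_minimum h U G \<longleftrightarrow> (\<forall>x\<in>U. G x = 0)"
proof -
  have cont: "continuous_on U G"
    using assms(3) by (auto simp: symmetric_components_on_def smooth_on_imp_continuous_on)
  have "energy h U (\<lambda>_. 0) = 0"
    by (simp add: energy_def)
  then have "global_minimum h U G \<longleftrightarrow> energy h U G = 0"
    using assms(3) symmetric_components_on_zero[of U]
    unfolding global_minimum_def by (metis le_zero_eq zero_le)
  with energy_eq_0_iff[OF assms(1,2) cont assms(4)] show ?thesis by simp
qed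

text \<open>The statement is made chart by chart: the transformation law has an inhomogeneous term,
  so vanishing of the components depends on the chart.\<close>

theorem theorem3p1:
  fixes X :: "'a topology"
    and A :: "('a, 'n::finite) chart set"
    and g :: "('a, 'n) chart \<Rightarrow> real^'n \<Rightarrow> real^'n^'n"
    and \<Gamma> :: "('a, 'n) chart \<Rightarrow> real^'n \<Rightarrow> 'n components"
    and c :: "('a, 'n) chart"
  assumes "oriented_riemannian_manifold X A g"
    and "symmetric_affine_connection A \<Gamma>"
    and "c \<in> A"
  shows "(euler_lagrange (g c) (chart_image c) (\<Gamma> c) \<longleftrightarrow> (\<forall>x\<in>chart_image c. \<Gamma> c x = 0)) \<and>
    (global_minimum (g c) (chart_image c) (\<Gamma> c) \<longleftrightarrow> (\<forall>x\<in>chart_image c. \<Gamma> c x = 0)) \<and>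
    euler_lagrange (g c) (chart_image c) (\<lambda>x. 0) \<and>
    global_minimum (g c) (chart_image c) (\<lambda>x. 0) \<and>
    (\<forall>x\<in>chart_image c. \<forall>G. lagrangian (g c x) 0 \<le> lagrangian (g c x) G)"
proof -
  let ?U = "chart_image c"
  have op: "open ?U"
    using assms(1,3) by (auto simp: oriented_riemannian_manifold_def oriented_smooth_manifold_def)
  have pd: "pos_def (g c x)" if "x \<in> ?U" for x
    using assms(1,3) that
    by (auto simp: oriented_riemannian_manifold_def riemannian_metric_def pos_def_def)
  have cont: "continuous_on ?U (g c)"
    using assms(1,3) smooth_on_imp_continuous_on
    by (auto simp: oriented_riemannian_manifold_def riemannian_metric_def)
  have sym: "symmetric_components_on ?U (\<Gamma> c)"
    using assms(2,3) by (auto simp: symmetric_affine_connection_def)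
  \<comment> \<open>Kept general in \<open>G\<close>, to serve both \<open>\<Gamma> c\<close> and
    the zero field.\<close>
  have EL: "euler_lagrange (g c) ?U G \<longleftrightarrow> (\<forall>x\<in>?U. G x = 0)" for G
    using critical_lagrangian_iff[OF pd] by (auto simp: euler_lagrange_def)
  show ?thesis
    using EL global_minimum_iff[OF op cont sym pd]
      global_minimum_iff[OF op cont symmetric_components_on_zero pd] lagrangian_nonneg[OF pd] by auto
qed

end
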